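(* Let $V$ be a 2-dimensional vector space over $k$ with a fixed basis $x,y$, and let $\mathsf w\in V^{\otimes4}$. If $c(\mathsf w)\notin\operatorname{Sym}^4V$, then $J(\mathsf w)=S^{\lambda}_f$ (that is, $x\mapsto x$, $y\mapsto y$ induces an isomorphism of graded algebras), where $$\lambda=-\frac{3}{8\mu(c(\mathsf w))}\in k,\qquad f=\overline{\mathsf w}-\frac{4\mu(c(\mathsf w))}{3}z^2\in k[x,y,z],$$ with $\deg x=\deg y=1$, $\deg z=2$.
   Context: $k$ is an algebraically closed field of characteristic $0$. Let $\phi(v_1\otimes\cdots\otimes v_4)=v_4\otimes v_1\otimes v_2\otimes v_3$ and $c(\mathsf w)=\frac14\sum_{i=0}^3\phi^i(\mathsf w)$. $\operatorname{Sym}^mV$ and $\operatorname{Alt}^mV$ denote the subspaces of $V^{\otimes m}$ of tensors $\mathsf w$ with $\theta(\mathsf w)=\mathsf w$, respectively $\theta(\mathsf w)=(\operatorname{sgn}\theta)\mathsf w$, for all $\theta\in\mathfrak S_m$. For words in $x,y$, $\partial_x$ removes an initial letter $x$ (and gives $0$ if the word does not start with $x$), similarly $\partial_y$; extend linearly. The Jacobian algebra is $J(\mathsf w)=k\langle x,y\rangle/(\partial_xc(\mathsf w),\partial_yc(\mathsf w))$. The map $\mu$: since $V^{\otimes2}=\operatorname{Sym}^2V\oplus\operatorname{Alt}^2V$, one has $V^{\otimes4}=(\operatorname{Sym}^2V)^{\otimes2}\oplus(\operatorname{Sym}^2V\otimes\operatorname{Alt}^2V)\oplus(\operatorname{Alt}^2V\otimes\operatorname{Sym}^2V)\oplus(\operatorname{Alt}^2V)^{\otimes2}$.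 Let $\pi:V^{\otimes4}\to(\operatorname{Alt}^2V)^{\otimes2}$ be the projection. $(\operatorname{Alt}^2V)^{\otimes2}=k\mathsf w_0$ with $\mathsf w_0=xyxy-xy^2x-yx^2y+yxyx$, and $\mu:V^{\otimes4}\to k$ is defined by $\pi(\mathsf w)=\mu(\mathsf w)\mathsf w_0$. (One has $\mu(c(\mathsf w))\neq0$ when $c(\mathsf w)\notin\operatorname{Sym}^4V$.) $\overline{\mathsf w}\in k[x,y]_4$ is the image of $\mathsf w$ under the quotient $k\langle x,y\rangle\to k[x,y]$. For a polynomial $g$ in commuting variables, $\widetilde g$ is its symmetrization: the linear map sending a commutative monomial $u_1\cdots u_m$ (product of $m$ variables) to $\frac1{m!}\sum_{\theta\in\mathfrak S_m}u_{\theta(1)}\cdots u_{\theta(m)}$ in the free algebra. $f_x,f_y,f_z$ are the usual partial derivatives and $[a,b]=ab-ba$. For $\lambda\in k$ and $f\in k[x,y,z]$ weighted homogeneous of degree $4$ with $\deg x=\deg y=1$, $\deg z=2$, $$S^\lambda_f:=k\langle x,y,z\rangle/([y,z]-\lambda\widetilde{f_x},\;[z,x]-\lambda\widetilde{f_y},\;[x,y]-\lambda\widetilde{f_z}).$$ *)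

theory Defs
  imports
    "HOL-Library.Poly_Mapping"
    "HOL-Combinatorics.Permutations"
    "HOL-Algebra.QuotRing"
    "HOL-Algebra.Algebraic_Closure_Type"
begin

section \<open>Free algebras and commutative polynomials\<close>

text \<open>
  Words form a monoid under concatenation, so finitely supported functions on words carry the
  multiplication of the free algebra. Finitely supported functions on exponent vectors are the
  commutative polynomials.
\<close>

instantiation list :: (type) monoid_add
begin
definition zero_list :: "'a list" where "zero_list = []"
definition plus_list :: "'a list \<Rightarrow> 'a list \<Rightarrow> 'a list" where "plus_list = (@)"
instance by standard (simp_all add: zero_list_def plus_list_def)
end

type_synonym ('g, 'k) free_alg = "'g list \<Rightarrow>\<^sub>0 'k"
type_synonym ('g, 'k) comm_poly = "('g \<Rightarrow>\<^sub>0 nat) \<Rightarrow>\<^sub>0 'k"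

definition const :: "'k \<Rightarrow> 'm::monoid_add \<Rightarrow>\<^sub>0 'k::field"
  where "const c = Poly_Mapping.single 0 c"

definition scale :: "'k \<Rightarrow> ('m \<Rightarrow>\<^sub>0 'k) \<Rightarrow> 'm::monoid_add \<Rightarrow>\<^sub>0 'k::field"
  where "scale c u = const c * u"

definition basis :: "'m \<Rightarrow> 'm \<Rightarrow>\<^sub>0 'k::field"
  where "basis b = Poly_Mapping.single b 1"

definition gen :: "'g \<Rightarrow> ('g, 'k::field) free_alg"
  where "gen a = basis [a]"

text \<open>The linear map with prescribed values on basis elements.\<close>

definition lin :: "('b \<Rightarrow> 'm \<Rightarrow>\<^sub>0 'k) \<Rightarrow> ('b \<Rightarrow>\<^sub>0 'k) \<Rightarrow> 'm::monoid_add \<Rightarrow>\<^sub>0 'k::field"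
  where "lin h u = (\<Sum>b\<in>Poly_Mapping.keys u. scale (Poly_Mapping.lookup u b) (h b))"

global_interpretation pm: vector_space "scale :: 'k::field \<Rightarrow> ('m::monoid_add \<Rightarrow>\<^sub>0 'k) \<Rightarrow> _"
  defines pm_span = pm.span
proof
  fix a b :: 'k and u v :: "'m \<Rightarrow>\<^sub>0 'k"
  show "scale a (u + v) = scale a u + scale a v"
    by (simp add: scale_def distrib_left)
  show "scale (a + b) u = scale a u + scale b u"
    by (simp add: scale_def const_def single_add distrib_right)
  show "scale a (scale b u) = scale (a * b) u"
    by (simp add: scale_def const_def mult.assoc [symmetric] mult_single)
  show "scale 1 u = u"
    by (simp add: scale_def const_def)
qed

datatype xy = X2 | Y2
datatype xyz = X3 | Y3 | Z3


section \<open>Tensors\<close>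

text \<open>
  \<open>V\<close> is the vector space with basis \<open>x, y\<close>; its \<open>m\<close>-th tensor power is identified with the span of
  the words of length \<open>m\<close> in the free algebra, and the tensor product of tensors with the product
  of the free algebra.
\<close>

definition tensor_power :: "nat \<Rightarrow> (xy, 'k::field) free_alg set"
  where "tensor_power m = {u. \<forall>w\<in>Poly_Mapping.keys u. length w = m}"

text \<open>
  Replacing this place permutation action by its inverse changes neither of the following two
  subspaces.
\<close>

definition perm_act :: "(nat \<Rightarrow> nat) \<Rightarrow> (xy, 'k) free_alg \<Rightarrow> (xy, 'k::field) free_alg"
  where "perm_act \<theta> = lin (\<lambda>w. basis (permute_list \<theta> w))"

definition Sym_tensors :: "nat \<Rightarrow> (xy, 'k::field) free_alg set"
  where "Sym_tensors m =
    {u \<in> tensor_power m. \<forall>\<theta>. \<theta> permutes {..<m} \<longrightarrow> perm_act \<theta> u = u}"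

definition Alt_tensors :: "nat \<Rightarrow> (xy, 'k::field) free_alg set"
  where "Alt_tensors m =
    {u \<in> tensor_power m. \<forall>\<theta>. \<theta> permutes {..<m} \<longrightarrow> perm_act \<theta> u = scale (of_int (sign \<theta>)) u}"

definition tensor_prod ::
    "(xy, 'k) free_alg set \<Rightarrow> (xy, 'k) free_alg set \<Rightarrow> (xy, 'k::field) free_alg set"
  where "tensor_prod A B = pm_span {a * b | a b. a \<in> A \<and> b \<in> B}"

text \<open>Only used on the fourth tensor power; words of other lengths are sent to \<open>0\<close>.\<close>

definition rot4 :: "(xy, 'k) free_alg \<Rightarrow> (xy, 'k::field) free_alg"
  where "rot4 = lin (\<lambda>w. case w of [v1, v2, v3, v4] \<Rightarrow> basis [v4, v1, v2, v3] | _ \<Rightarrow> 0)"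

definition cyc :: "(xy, 'k) free_alg \<Rightarrow> (xy, 'k::field) free_alg"
  where "cyc u = scale (1 / 4) (\<Sum>i = 0..3. (rot4 ^^ i) u)"

text \<open>
  The projection to the last summand of
  \<open>(Sym \<oplus> Alt) \<otimes> (Sym \<oplus> Alt) =
    (Sym \<otimes> Sym) \<oplus> (Sym \<otimes> Alt) \<oplus> (Alt \<otimes> Sym) \<oplus> (Alt \<otimes> Alt)\<close>, where \<open>Sym\<close> and \<open>Alt\<close> are in degree 2.
\<close>

definition proj_alt :: "(xy, 'k) free_alg \<Rightarrow> (xy, 'k::field) free_alg"
  where "proj_alt u = (THE p. p \<in> tensor_prod (Alt_tensors 2) (Alt_tensors 2) \<and>
    (\<exists>q \<in> tensor_prod (Sym_tensors 2) (Sym_tensors 2).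
     \<exists>r \<in> tensor_prod (Sym_tensors 2) (Alt_tensors 2).
     \<exists>s \<in> tensor_prod (Alt_tensors 2) (Sym_tensors 2). u = q + r + s + p))"

definition w0 :: "(xy, 'k::field) free_alg"
  where "w0 = basis [X2, Y2, X2, Y2] - basis [X2, Y2, Y2, X2]
            - basis [Y2, X2, X2, Y2] + basis [Y2, X2, Y2, X2]"

definition mu :: "(xy, 'k) free_alg \<Rightarrow> 'k::field"
  where "mu u = (THE m. proj_alt u = scale m w0)"


section \<open>Polynomials and symmetrization\<close>

definition commutative_image :: "('g, 'k) free_alg \<Rightarrow> ('g, 'k::field) comm_poly"
  where "commutative_image = lin (\<lambda>w. basis (\<Sum>a\<leftarrow>w. Poly_Mapping.single a 1))"

definition poly_incl :: "(xy, 'k) comm_poly \<Rightarrow> (xyz, 'k::field) comm_poly"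
  where "poly_incl = lin (\<lambda>e. basis (Poly_Mapping.single X3 (Poly_Mapping.lookup e X2)
                                + Poly_Mapping.single Y3 (Poly_Mapping.lookup e Y2)))"

text \<open>If \<open>a\<close> does not occur in a monomial, the truncated subtraction is harmless: the coefficient is 0.\<close>

definition partial :: "'g \<Rightarrow> ('g, 'k) comm_poly \<Rightarrow> ('g, 'k::field) comm_poly"
  where "partial a = lin (\<lambda>e. scale (of_nat (Poly_Mapping.lookup e a))
                              (basis (e - Poly_Mapping.single a 1)))"

definition ordered_word :: "(xyz \<Rightarrow>\<^sub>0 nat) \<Rightarrow> xyz list"
  where "ordered_word e = replicate (Poly_Mapping.lookup e X3) X3
                        @ replicate (Poly_Mapping.lookup e Y3) Y3
                        @ replicate (Poly_Mapping.lookup e Z3) Z3"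

definition symmetrization :: "(xyz, 'k) comm_poly \<Rightarrow> (xyz, 'k::field_char_0) free_alg"
  where "symmetrization = lin (\<lambda>e. let u = ordered_word e; m = length u in
    scale (1 / fact m) (\<Sum>\<theta> | \<theta> permutes {..<m}. basis (permute_list \<theta> u)))"


section \<open>Graded algebras given by generators and relations\<close>

record ('k, 'a) graded_algebra = "'a ring" +
  scalar :: "'k \<Rightarrow> 'a"
  component :: "nat \<Rightarrow> 'a set"

definition homogeneous :: "('g \<Rightarrow> nat) \<Rightarrow> nat \<Rightarrow> ('g, 'k::field) free_alg set"
  where "homogeneous wt n = {u. \<forall>w\<in>Poly_Mapping.keys u. (\<Sum>a\<leftarrow>w. wt a) = n}"

abbreviation free_ring :: "('g, 'k::field) free_alg ring"
  where "free_ring \<equiv> ring_of_type_algebra"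

text \<open>The class of \<open>u\<close> modulo the two-sided ideal generated by the relations \<open>R\<close>.\<close>

definition cls :: "('g, 'k) free_alg set \<Rightarrow> ('g, 'k::field) free_alg \<Rightarrow> ('g, 'k) free_alg set"
  where "cls R u = (Idl\<^bsub>free_ring\<^esub> R) +>\<^bsub>free_ring\<^esub> u"

definition presented_algebra ::
    "('g \<Rightarrow> nat) \<Rightarrow> ('g, 'k::field) free_alg set \<Rightarrow> ('k, ('g, 'k) free_alg set) graded_algebra"
  where "presented_algebra wt R =
    ring.extend (free_ring Quot (Idl\<^bsub>free_ring\<^esub> R))
      (graded_algebra.fields (\<lambda>c. cls R (const c)) (\<lambda>n. cls R ` homogeneous wt n))"

definition graded_algebra_iso ::
    "('k, 'a) graded_algebra \<Rightarrow> ('k, 'b) graded_algebra \<Rightarrow> ('a \<Rightarrow> 'b) set"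
  where "graded_algebra_iso A B =
    {h \<in> ring_iso A B. (\<forall>c. h (scalar A c) = scalar B c) \<and>
                       (\<forall>n. h ` component A n = component B n)}"

definition remove_initial :: "'g \<Rightarrow> ('g, 'k) free_alg \<Rightarrow> ('g, 'k::field) free_alg"
  where "remove_initial a = lin (\<lambda>w. case w of [] \<Rightarrow> 0 | b # v \<Rightarrow> if b = a then basis v else 0)"

definition J_rels :: "(xy, 'k) free_alg \<Rightarrow> (xy, 'k::field) free_alg set"
  where "J_rels w = {remove_initial X2 (cyc w), remove_initial Y2 (cyc w)}"

definition jacobian_algebra :: "(xy, 'k::field) free_alg \<Rightarrow> ('k, (xy, 'k) free_alg set) graded_algebra"
  where "jacobian_algebra w = presented_algebra (\<lambda>_. 1) (J_rels w)"

definition commutator :: "'a::ring \<Rightarrow> 'a \<Rightarrow> 'a"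
  where "commutator a b = a * b - b * a"

fun deg_xyz :: "xyz \<Rightarrow> nat" where
  "deg_xyz X3 = 1"
| "deg_xyz Y3 = 1"
| "deg_xyz Z3 = 2"

definition S_rels :: "'k \<Rightarrow> (xyz, 'k) comm_poly \<Rightarrow> (xyz, 'k::field_char_0) free_alg set"
  where "S_rels l f =
    {commutator (gen Y3) (gen Z3) - scale l (symmetrization (partial X3 f)),
     commutator (gen Z3) (gen X3) - scale l (symmetrization (partial Y3 f)),
     commutator (gen X3) (gen Y3) - scale l (symmetrization (partial Z3 f))}"

definition S_algebra :: "'k \<Rightarrow> (xyz, 'k::field_char_0) comm_poly \<Rightarrow>
    ('k, (xyz, 'k) free_alg set) graded_algebra"
  where "S_algebra l f = presented_algebra deg_xyz (S_rels l f)"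

end

theory Submission
  imports Defs
begin

text \<open>
  Write the coefficients of \<open>c(w)\<close> at \<open>x\<^sup>2y\<^sup>2\<close> and \<open>xyxy\<close> as \<open>b\<close> and \<open>d\<close>. Then
  \<open>\<mu>(c(w)) = (d - b) / 2\<close>, which vanishes only if \<open>c(w)\<close> is symmetric. The constants \<open>\<lambda>\<close> and \<open>f\<close>
  are chosen so that the relation for \<open>[x, y]\<close> in \<open>S\<close> reads \<open>z = [x, y]\<close>. Eliminating \<open>z\<close>, the
  other two relations become nonzero multiples of \<open>\<partial>\<^sub>x c(w)\<close> and \<open>\<partial>\<^sub>y c(w)\<close>, because
  \<open>4 \<partial>\<^sub>x c(w)\<close> is the symmetrization of \<open>f\<^sub>x\<close> plus \<open>(8\<mu>/3) [y, [x, y]]\<close>, and likewise for \<open>y\<close>.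
\<close>

section \<open>Linear maps\<close>

text \<open>Multiplication by a constant agrees with coefficientwise scaling. As a simp rule this
  allows identities of tensors to be checked one coefficient at a time, which is how the explicit
  computations below are done.\<close>

lemma lookup_scale [simp]:
  "Poly_Mapping.lookup (scale c u) k = c * Poly_Mapping.lookup u k"
  by (simp add: scale_def const_def flip: mult_map_scale_conv_mult)
     (simp add: Poly_Mapping.map.rep_eq when_def)

lemma scale_mult_left: "scale c u * v = scale c (u * v)"
  by (simp add: scale_def mult.assoc)

lemma single_eq_scale_basis: "Poly_Mapping.single b c = scale c (basis b)"
  by (simp add: scale_def const_def basis_def mult_single)

lemma sum_lookup_basis:
  "u = (\<Sum>b\<in>Poly_Mapping.keys u. scale (Poly_Mapping.lookup u b) (basis b))"
  by (rule poly_mapping_eqI)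
     (auto simp: lookup_sum lookup_single when_def in_keys_iff simp flip: single_eq_scale_basis)

lemma free_module_induct [case_names zero add basis]:
  assumes "P 0"
    and "\<And>u v. P u \<Longrightarrow> P v \<Longrightarrow> P (u + v)"
    and "\<And>c b. P (scale c (basis b))"
  shows "P u"
proof -
  have "P (\<Sum>b\<in>B. scale (f b) (basis b))" if "finite B" for B f
    using that by (induction B rule: finite_induct) (auto intro: assms)
  then show ?thesis
    by (subst sum_lookup_basis) simp
qed

text \<open>\<open>scale\<close> multiplies by a constant on the left, so the claim amounts to
  constants being central; this holds on basis elements because the empty word is neutral on both
  sides and the field is commutative.\<close>

lemma scale_mult_right: "u * scale c v = scale c (u * v)"
proof -
  have "u * const c = const c * u"
  proof (induction u rule: free_module_induct)
    case (add u v)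
    then show ?case by (simp add: distrib_left distrib_right)
  next
    case (basis d b)
    then show ?case
      by (simp add: const_def mult_single mult.commute flip: single_eq_scale_basis)
  qed simp
  then show ?thesis
    by (metis mult.assoc scale_def)
qed

lemma basis_mult: "basis u * basis v = basis (u + v)"
  by (simp add: basis_def mult_single)

lemma basis_mult_word: "basis u * basis v = basis (u @ v)"
  by (simp add: basis_mult plus_list_def)

text \<open>Supports shrink under cancellation, so additivity of \<open>lin\<close> needs a common
  index set for all the sums involved.\<close>

lemma lin_superset:
  assumes "finite B" "Poly_Mapping.keys u \<subseteq> B"
  shows "lin h u = (\<Sum>b\<in>B. scale (Poly_Mapping.lookup u b) (h b))"
  unfolding lin_def using assms
  by (intro sum.mono_neutral_left) (auto simp: in_keys_iff)

lemma lin_zero [simp]: "lin h 0 = 0"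
  by (simp add: lin_def)

lemma lin_add: "lin h (u + v) = lin h u + lin h v"
proof -
  let ?B = "Poly_Mapping.keys u \<union> Poly_Mapping.keys v"
  have "Poly_Mapping.keys (u + v) \<subseteq> ?B"
    by (rule keys_add)
  then show ?thesis
    by (simp add: lin_superset[of ?B] lookup_add pm.scale_left_distrib sum.distrib)
qed

lemma lin_scale: "lin h (scale c u) = scale c (lin h u)"
proof -
  have "Poly_Mapping.keys (scale c u) \<subseteq> Poly_Mapping.keys u"
    by (auto simp: in_keys_iff)
  then have "lin h (scale c u) = (\<Sum>b\<in>Poly_Mapping.keys u. scale (c * Poly_Mapping.lookup u b) (h b))"
    by (simp add: lin_superset[of "Poly_Mapping.keys u"])
  then show ?thesis
    by (simp add: lin_def pm.scale_sum_right)
qed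

lemma lin_diff: "lin h (u - v) = lin h u - lin h v"
  by (metis add_diff_cancel_right' diff_add_cancel lin_add)

lemma lin_basis [simp]: "lin h (basis b) = h b"
  by (simp add: lin_def basis_def)

lemma lin_sum: "lin h (sum f B) = (\<Sum>b\<in>B. lin h (f b))"
  by (induction B rule: infinite_finite_induct) (auto simp: lin_add)

lemma lin_mult:
  assumes "\<And>a b. h (a + b) = h a * h b"
  shows "lin h (u * v) = lin h u * lin h v"
proof (induction u rule: free_module_induct)
  case (add u u')
  then show ?case by (simp add: distrib_right lin_add)
next
  case (basis c a)
  show ?case
  proof (induction v rule: free_module_induct)
    case (add v v')
    then show ?case by (simp add: distrib_left lin_add)
  next
    case (basis d b)
    show ?case
      by (simp add: scale_mult_left scale_mult_right basis_mult lin_scale assms)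
  qed simp
qed simp

section \<open>Homomorphisms of free algebras\<close>

text \<open>The algebra homomorphism that the universal property of the free algebra attaches to
  \<open>\<phi>\<close>.\<close>

definition subst_hom :: "('g \<Rightarrow> ('h, 'k) free_alg) \<Rightarrow> ('g, 'k) free_alg \<Rightarrow> ('h, 'k::field) free_alg"
  where "subst_hom \<phi> = lin (\<lambda>w. prod_list (map \<phi> w))"

lemma subst_hom_zero [simp]: "subst_hom \<phi> 0 = 0"
  by (simp add: subst_hom_def)

lemma subst_hom_add: "subst_hom \<phi> (u + v) = subst_hom \<phi> u + subst_hom \<phi> v"
  by (simp add: subst_hom_def lin_add)

lemma subst_hom_diff: "subst_hom \<phi> (u - v) = subst_hom \<phi> u - subst_hom \<phi> v"
  by (simp add: subst_hom_def lin_diff)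

lemma subst_hom_scale: "subst_hom \<phi> (scale c u) = scale c (subst_hom \<phi> u)"
  by (simp add: subst_hom_def lin_scale)

lemma subst_hom_mult: "subst_hom \<phi> (u * v) = subst_hom \<phi> u * subst_hom \<phi> v"
  by (simp add: subst_hom_def lin_mult plus_list_def)

lemma subst_hom_basis [simp]: "subst_hom \<phi> (basis w) = prod_list (map \<phi> w)"
  by (simp add: subst_hom_def)

lemma subst_hom_gen [simp]: "subst_hom \<phi> (gen a) = \<phi> a"
  by (simp add: gen_def)

lemma basis_Nil: "basis [] = (1 :: ('g, 'k::field) free_alg)"
  by (simp add: basis_def flip: zero_list_def)

lemma const_eq_scale_one: "const c = scale c 1"
  by (simp add: scale_def)

lemma subst_hom_one [simp]: "subst_hom \<phi> 1 = 1"
  by (simp flip: basis_Nil)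

lemma subst_hom_const [simp]: "subst_hom \<phi> (const c) = const c"
  by (simp add: const_eq_scale_one subst_hom_scale)

lemma basis_Cons: "basis (a # w) = gen a * basis w"
  by (simp add: gen_def basis_mult_word)

lemma free_alg_induct [case_names zero one gen_mult add scale]:
  fixes u :: "('g, 'k::field) free_alg"
  assumes "P 0"
    and "P 1"
    and "\<And>a u. P u \<Longrightarrow> P (gen a * u)"
    and "\<And>u v. P u \<Longrightarrow> P v \<Longrightarrow> P (u + v)"
    and "\<And>c u. P u \<Longrightarrow> P (scale c u)"
  shows "P u"
proof (induction u rule: free_module_induct)
  case (basis c w)
  have "P (basis w)"
    by (induction w) (simp_all add: basis_Nil basis_Cons assms)
  then show ?case by (rule assms)
qed (fact assms)+

lemma subst_hom_subst_hom:
  "subst_hom \<phi> (subst_hom \<psi> u) = subst_hom (\<lambda>a. subst_hom \<phi> (\<psi> a)) u"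
  by (induction u rule: free_alg_induct)
     (simp_all add: subst_hom_add subst_hom_mult subst_hom_scale)

section \<open>Homogeneous elements and degree-preserving substitutions\<close>

lemma homogeneous_zero: "0 \<in> homogeneous wt n"
  by (simp add: homogeneous_def)

lemma homogeneous_add:
  "u \<in> homogeneous wt n \<Longrightarrow> v \<in> homogeneous wt n \<Longrightarrow> u + v \<in> homogeneous wt n"
  using keys_add[of u v] by (auto simp: homogeneous_def)

lemma homogeneous_scale: "u \<in> homogeneous wt n \<Longrightarrow> scale c u \<in> homogeneous wt n"
  by (auto simp: homogeneous_def in_keys_iff)

lemma homogeneous_diff:
  assumes "u \<in> homogeneous wt n" "v \<in> homogeneous wt n"
  shows "u - v \<in> homogeneous wt n"
  using homogeneous_add[OF assms(1) homogeneous_scale[OF assms(2), of "-1"]] by simp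

lemma homogeneous_basis: "(\<Sum>a\<leftarrow>w. wt a) = n \<Longrightarrow> basis w \<in> homogeneous wt n"
  by (simp add: homogeneous_def basis_def)

lemma homogeneous_sum:
  "(\<And>b. b \<in> B \<Longrightarrow> f b \<in> homogeneous wt n) \<Longrightarrow> sum f B \<in> homogeneous wt n"
  by (induction B rule: infinite_finite_induct) (auto intro: homogeneous_zero homogeneous_add)

lemma homogeneous_mult:
  assumes "u \<in> homogeneous wt m" "v \<in> homogeneous wt n"
  shows "u * v \<in> homogeneous wt (m + n)"
  using keys_mult[of u v] assms by (fastforce simp: homogeneous_def plus_list_def)

lemma homogeneous_subst_hom:
  assumes \<phi>: "\<And>a. \<phi> a \<in> homogeneous wt' (wt a)" and u: "u \<in> homogeneous wt n"
  shows "subst_hom \<phi> u \<in> homogeneous wt' n"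
proof -
  have "prod_list (map \<phi> w) \<in> homogeneous wt' (\<Sum>a\<leftarrow>w. wt a)" for w
    by (induction w)
       (auto intro: \<phi> homogeneous_mult simp: homogeneous_basis simp flip: basis_Nil)
  then show ?thesis
    unfolding subst_hom_def lin_def using u
    by (fastforce intro!: homogeneous_sum homogeneous_scale simp: homogeneous_def)
qed

section \<open>Ideals and presentations\<close>

lemma ring_of_type_algebra_simps [simp]:
  "carrier ring_of_type_algebra = UNIV"
  "x \<otimes>\<^bsub>ring_of_type_algebra\<^esub> y = x * y"
  "x \<oplus>\<^bsub>ring_of_type_algebra\<^esub> y = x + y"
  "\<one>\<^bsub>ring_of_type_algebra\<^esub> = 1"
  "\<zero>\<^bsub>ring_of_type_algebra\<^esub> = 0"
  by (simp_all add: ring_of_type_algebra_def)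

lemma ring_ring_of_type_algebra: "ring (ring_of_type_algebra :: 'a::ring_1 ring)"
proof -
  have "\<exists>y. x + y = 0" for x :: 'a
    using add.right_inverse by blast
  then show ?thesis
    by unfold_locales (auto simp: algebra_simps Units_def)
qed

abbreviation Idl_free :: "('g, 'k) free_alg set \<Rightarrow> ('g, 'k::field) free_alg set"
  where "Idl_free R \<equiv> Idl\<^bsub>free_ring\<^esub> R"

lemma Idl_free_ideal: "ideal (Idl_free R) free_ring"
  by (rule ring.genideal_ideal[OF ring_ring_of_type_algebra]) simp

lemma Idl_free_self: "u \<in> R \<Longrightarrow> u \<in> Idl_free R"
  using ring.genideal_self[OF ring_ring_of_type_algebra, of R] by auto

lemma Idl_free_zero [simp]: "0 \<in> Idl_free R"
  using additive_subgroup.zero_closed[OF ideal.axioms(1)[OF Idl_free_ideal]] by simp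

lemma Idl_free_add: "u \<in> Idl_free R \<Longrightarrow> v \<in> Idl_free R \<Longrightarrow> u + v \<in> Idl_free R"
  using additive_subgroup.a_closed[OF ideal.axioms(1)[OF Idl_free_ideal]] by simp

lemma Idl_free_mult_left: "u \<in> Idl_free R \<Longrightarrow> v * u \<in> Idl_free R"
  using ideal.I_l_closed[OF Idl_free_ideal] by simp

lemma Idl_free_mult_right: "u \<in> Idl_free R \<Longrightarrow> u * v \<in> Idl_free R"
  using ideal.I_r_closed[OF Idl_free_ideal] by simp

lemma Idl_free_scale: "u \<in> Idl_free R \<Longrightarrow> scale c u \<in> Idl_free R"
  by (simp add: scale_def Idl_free_mult_left)

lemma Idl_free_diff: "u \<in> Idl_free R \<Longrightarrow> v \<in> Idl_free R \<Longrightarrow> u - v \<in> Idl_free R"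
  using Idl_free_add[of u R "scale (-1) v"] Idl_free_scale[of v R "-1"] by simp

text \<open>The elements satisfying \<open>P\<close> form a two-sided ideal containing
  \<open>R\<close>, hence contain the ideal generated by \<open>R\<close>. Negation has no case of
  its own, since it is left multiplication by \<open>- 1\<close>.\<close>

lemma Idl_free_induct [consumes 1, case_names base zero add mult_left mult_right]:
  assumes "u \<in> Idl_free R"
    and "\<And>u. u \<in> R \<Longrightarrow> P u"
    and "P 0"
    and "\<And>u v. P u \<Longrightarrow> P v \<Longrightarrow> P (u + v)"
    and "\<And>u v. P u \<Longrightarrow> P (v * u)"
    and "\<And>u v. P u \<Longrightarrow> P (u * v)"
  shows "P u"
proof -
  interpret ring "free_ring :: ('a, 'b) free_alg ring"
    by (rule ring_ring_of_type_algebra)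
  have neg: "\<ominus>\<^bsub>free_ring\<^esub> x = - x" for x :: "('a, 'b) free_alg"
    by (rule minus_equality) simp_all
  have minus: "P (- u)" if "P u" for u
    using assms(5)[OF that, of "- 1"] by simp
  have "subgroup {u. P u} (add_monoid free_ring)"
    by (rule add.subgroupI) (use assms(3-4) minus in \<open>auto simp: neg\<close>)
  then have "ideal {u. P u} free_ring"
    by (rule idealI[OF ring_axioms]) (auto simp: assms)
  then show ?thesis
    using genideal_minimal[of "{u. P u}" R] assms by auto
qed

lemma subst_hom_Idl_free:
  assumes "subst_hom \<phi> ` R \<subseteq> Idl_free S" "u \<in> Idl_free R"
  shows "subst_hom \<phi> u \<in> Idl_free S"
  using assms(2)
proof (induction u rule: Idl_free_induct)
  case (base u)
  then show ?case using assms(1) by auto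
qed (simp_all add: subst_hom_add subst_hom_mult Idl_free_add Idl_free_mult_left Idl_free_mult_right)

text \<open>An endomorphism that is the identity on generators modulo an ideal is the identity
  modulo that ideal; for a product the difference telescopes into two terms of the ideal.\<close>

lemma subst_hom_minus_self:
  assumes "\<And>a. \<phi> a - gen a \<in> Idl_free R"
  shows "subst_hom \<phi> u - u \<in> Idl_free R"
proof (induction u rule: free_alg_induct)
  case (gen_mult a u)
  have "\<phi> a * subst_hom \<phi> u - gen a * u = (\<phi> a - gen a) * subst_hom \<phi> u + gen a * (subst_hom \<phi> u - u)"
    by (simp add: algebra_simps)
  with gen_mult assms show ?case
    by (simp add: subst_hom_mult Idl_free_add Idl_free_mult_left Idl_free_mult_right)
next
  case (add u v)
  then show ?case
    using Idl_free_add[OF add] by (simp add: subst_hom_add algebra_simps)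
next
  case (scale c u)
  then show ?case
    using Idl_free_scale[OF scale, of c] by (simp add: subst_hom_scale pm.scale_right_diff_distrib)
qed simp_all

section \<open>Residue classes and isomorphisms of presented algebras\<close>

lemma cls_eq_image: "cls R u = (\<lambda>i. i + u) ` Idl_free R"
  by (auto simp: cls_def a_r_coset_def r_coset_def)

lemma cls_eq_iff: "cls R u = cls R v \<longleftrightarrow> u - v \<in> Idl_free R"
proof
  assume "cls R u = cls R v"
  moreover have "u \<in> cls R u"
    by (force simp: cls_eq_image)
  ultimately show "u - v \<in> Idl_free R"
    by (auto simp: cls_eq_image)
next
  assume *: "u - v \<in> Idl_free R"
  show "cls R u = cls R v"
  proof (intro equalityI subsetI)
    fix z assume "z \<in> cls R u"
    then have "z - u \<in> Idl_free R" by (auto simp: cls_eq_image)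
    from Idl_free_add[OF this *] have "z - v \<in> Idl_free R" by simp
    then show "z \<in> cls R v"
      unfolding cls_eq_image by (intro image_eqI[of _ _ "z - v"]) auto
  next
    fix z assume "z \<in> cls R v"
    then have "z - v \<in> Idl_free R" by (auto simp: cls_eq_image)
    from Idl_free_diff[OF this *] have "z - u \<in> Idl_free R" by simp
    then show "z \<in> cls R u"
      unfolding cls_eq_image by (intro image_eqI[of _ _ "z - u"]) auto
  qed
qed

lemma presented_algebra_simps:
  "carrier (presented_algebra wt R) = range (cls R)"
  "cls R u \<otimes>\<^bsub>presented_algebra wt R\<^esub> cls R v = cls R (u * v)"
  "cls R u \<oplus>\<^bsub>presented_algebra wt R\<^esub> cls R v = cls R (u + v)"
  "\<one>\<^bsub>presented_algebra wt R\<^esub> = cls R 1"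
  "scalar (presented_algebra wt R) c = cls R (const c)"
  "component (presented_algebra wt R) n = cls R ` homogeneous wt n"
  using ring_hom_mult[OF ideal.rcos_ring_hom[OF Idl_free_ideal[of R]], of u v]
    ring_hom_add[OF ideal.rcos_ring_hom[OF Idl_free_ideal[of R]], of u v]
  by (auto simp: presented_algebra_def ring.extend_def graded_algebra.fields_def FactRing_def
        A_RCOSETS_def' cls_def)

text \<open>Both substitutions send relations into the other ideal and so descend to the quotients.
  The composites need to be the identity on generators only, by \<open>subst_hom_minus_self\<close>.
  Since both directions preserve degrees, components are mapped onto components.\<close>

lemma presented_algebra_iso:
  fixes \<phi> :: "'g \<Rightarrow> ('h, 'k::field) free_alg" and \<psi> :: "'h \<Rightarrow> ('g, 'k) free_alg"
  assumes \<phi>_deg: "\<And>a. \<phi> a \<in> homogeneous wt' (wt a)"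
    and \<psi>_deg: "\<And>b. \<psi> b \<in> homogeneous wt (wt' b)"
    and \<phi>_rel: "subst_hom \<phi> ` R \<subseteq> Idl_free S"
    and \<psi>_rel: "subst_hom \<psi> ` S \<subseteq> Idl_free R"
    and \<psi>\<phi>: "\<And>a. subst_hom \<psi> (\<phi> a) - gen a \<in> Idl_free R"
    and \<phi>\<psi>: "\<And>b. subst_hom \<phi> (\<psi> b) - gen b \<in> Idl_free S"
  obtains h where "h \<in> graded_algebra_iso (presented_algebra wt R) (presented_algebra wt' S)"
    and "\<And>u. h (cls R u) = cls S (subst_hom \<phi> u)"
proof
  \<comment> \<open>The map on residue classes goes through a chosen representative;
    \<open>\<phi>_cls\<close> shows that the choice does not matter.\<close>
  define h where "h C = cls S (subst_hom \<phi> (SOME u. cls R u = C))" for C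
  have left_inv: "cls R (subst_hom \<psi> (subst_hom \<phi> u)) = cls R u" for u
    unfolding cls_eq_iff subst_hom_subst_hom by (rule subst_hom_minus_self) (rule \<psi>\<phi>)
  have right_inv: "cls S (subst_hom \<phi> (subst_hom \<psi> u)) = cls S u" for u
    unfolding cls_eq_iff subst_hom_subst_hom by (rule subst_hom_minus_self) (rule \<phi>\<psi>)
  have \<phi>_cls: "cls S (subst_hom \<phi> u) = cls S (subst_hom \<phi> v)" if "cls R u = cls R v" for u v
    using that subst_hom_Idl_free[OF \<phi>_rel] by (simp add: cls_eq_iff flip: subst_hom_diff)
  have \<psi>_cls: "cls R (subst_hom \<psi> u) = cls R (subst_hom \<psi> v)" if "cls S u = cls S v" for u v
    using that subst_hom_Idl_free[OF \<psi>_rel] by (simp add: cls_eq_iff flip: subst_hom_diff)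
  show h_cls: "h (cls R u) = cls S (subst_hom \<phi> u)" for u
    unfolding h_def by (rule \<phi>_cls) (rule someI[of _ u], rule refl)
  have "inj_on h (range (cls R))"
    by (rule inj_onI) (metis (no_types, lifting) \<psi>_cls left_inv h_cls imageE)
  moreover have "h ` range (cls R) = range (cls S)"
    by (auto simp: h_cls image_image) (metis right_inv rangeI)
  ultimately have "h \<in> ring_iso (presented_algebra wt R) (presented_algebra wt' S)"
    by (intro ring_iso_memI)
       (auto simp: presented_algebra_simps h_cls bij_betw_def subst_hom_mult subst_hom_add)
  moreover have "h ` cls R ` homogeneous wt n = cls S ` homogeneous wt' n" for n
  proof -
    have "subst_hom \<phi> u \<in> homogeneous wt' n" if "u \<in> homogeneous wt n" for u
      using \<phi>_deg that by (rule homogeneous_subst_hom)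
    moreover have "subst_hom \<psi> u \<in> homogeneous wt n" if "u \<in> homogeneous wt' n" for u
      using \<psi>_deg that by (rule homogeneous_subst_hom)
    ultimately show ?thesis
      by (auto simp: h_cls image_image) (metis right_inv image_eqI)
  qed
  ultimately show "h \<in> graded_algebra_iso (presented_algebra wt R) (presented_algebra wt' S)"
    by (simp add: graded_algebra_iso_def presented_algebra_simps h_cls)
qed

section \<open>The normal form of a cyclic quartic tensor\<close>

lemma lookup_basis: "Poly_Mapping.lookup (basis b) k = (if b = k then 1 else 0)"
  by (simp add: basis_def lookup_single when_def)

lemma words_Suc:
  "{v :: xy list. length v = Suc n} = (#) X2 ` {v. length v = n} \<union> (#) Y2 ` {v. length v = n}"
proof -
  have "xy = X2 \<or> xy = Y2" for xy
    by (cases xy) auto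
  then show ?thesis
    by (auto simp: length_Suc_conv)
qed

text \<open>The index set is the set of all words of length \<open>m\<close> and does not depend on
  \<open>u\<close>, so it can be enumerated for concrete \<open>m\<close> and reindexed by place
  permutations.\<close>

lemma tensor_power_sum_words:
  assumes "u \<in> tensor_power m"
  shows "u = (\<Sum>v | length v = m. scale (Poly_Mapping.lookup u v) (basis v))"
proof -
  have fin: "finite {v :: xy list. length v = m}"
    by (induction m) (simp_all add: words_Suc)
  have "lin basis u = (\<Sum>v | length v = m. scale (Poly_Mapping.lookup u v) (basis v))"
    using assms by (intro lin_superset fin) (auto simp: tensor_power_def)
  then show ?thesis
    using sum_lookup_basis[of u] by (simp add: lin_def)
qed

lemma tensor_power_2_cases:
  assumes "u \<in> tensor_power 2"
  obtains a b c d where "u = scale a (basis [X2, X2]) + scale b (basis [X2, Y2])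
    + scale c (basis [Y2, X2]) + scale d (basis [Y2, Y2])"
proof -
  have "{v :: xy list. length v = 2} = {[X2, X2], [X2, Y2], [Y2, X2], [Y2, Y2]}"
    by (auto simp: numeral_2_eq_2 words_Suc)
  with tensor_power_sum_words[OF assms] show ?thesis
    by (auto intro: that simp: add.assoc)
qed

text \<open>The general tensor invariant under rotation: one coefficient for each of the six
  rotation orbits on words of length 4. The orbits of \<open>xxyy\<close> (coefficient
  \<open>b\<close>) and \<open>xyxy\<close> (coefficient \<open>d\<close>) are the only two with the
  same number of letters \<open>y\<close>.\<close>

definition cyclic_form :: "'k \<Rightarrow> 'k \<Rightarrow> 'k \<Rightarrow> 'k \<Rightarrow> 'k \<Rightarrow> 'k \<Rightarrow> (xy, 'k::field) free_alg"
  where "cyclic_form a0 a1 b d a3 a4 =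
    scale a0 (basis [X2, X2, X2, X2])
    + scale a1 (basis [X2, X2, X2, Y2] + basis [X2, X2, Y2, X2]
              + basis [X2, Y2, X2, X2] + basis [Y2, X2, X2, X2])
    + scale b (basis [X2, X2, Y2, Y2] + basis [X2, Y2, Y2, X2]
              + basis [Y2, Y2, X2, X2] + basis [Y2, X2, X2, Y2])
    + scale d (basis [X2, Y2, X2, Y2] + basis [Y2, X2, Y2, X2])
    + scale a3 (basis [Y2, Y2, Y2, X2] + basis [Y2, Y2, X2, Y2]
              + basis [Y2, X2, Y2, Y2] + basis [X2, Y2, Y2, Y2])
    + scale a4 (basis [Y2, Y2, Y2, Y2])"

section \<open>Commutative monomials in three variables and their symmetrizations\<close>

definition mon :: "nat \<Rightarrow> nat \<Rightarrow> nat \<Rightarrow> xyz \<Rightarrow>\<^sub>0 nat"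
  where "mon i j k = Poly_Mapping.single X3 i + Poly_Mapping.single Y3 j + Poly_Mapping.single Z3 k"

lemma lookup_mon [simp]:
  "Poly_Mapping.lookup (mon i j k) X3 = i"
  "Poly_Mapping.lookup (mon i j k) Y3 = j"
  "Poly_Mapping.lookup (mon i j k) Z3 = k"
  by (simp_all add: mon_def lookup_add lookup_single)

lemma mon_minus_single:
  "mon i j k - Poly_Mapping.single X3 1 = mon (i - 1) j k"
  "mon i j k - Poly_Mapping.single Y3 1 = mon i (j - 1) k"
  "mon i j k - Poly_Mapping.single Z3 1 = mon i j (k - 1)"
  by (rule poly_mapping_eqI, rename_tac l, case_tac l, simp_all add: lookup_minus lookup_single)+

lemma single_Z3: "Poly_Mapping.single Z3 n = mon 0 0 n"
  by (simp add: mon_def)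

lemma poly_incl_commutative_image_basis:
  "poly_incl (commutative_image (basis v)) = basis (mon (count_list v X2) (count_list v Y2) 0)"
proof -
  have "Poly_Mapping.lookup (\<Sum>a\<leftarrow>v. Poly_Mapping.single a 1) b = count_list v b" for b
    by (induction v) (auto simp: lookup_add lookup_single when_def)
  then show ?thesis
    by (simp add: poly_incl_def commutative_image_def mon_def)
qed

lemma partial_basis_mon:
  "partial X3 (basis (mon i j k)) = scale (of_nat i) (basis (mon (i - 1) j k))"
  "partial Y3 (basis (mon i j k)) = scale (of_nat j) (basis (mon i (j - 1) k))"
  "partial Z3 (basis (mon i j k)) = scale (of_nat k) (basis (mon i j (k - 1)))"
  by (simp_all add: partial_def mon_minus_single[simplified])

lemma ordered_word_mon: "ordered_word (mon i j k) = replicate i X3 @ replicate j Y3 @ replicate k Z3"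
  by (simp add: ordered_word_def)

lemma sum_permutations_3:
  fixes f :: "'a list \<Rightarrow> 'b::comm_monoid_add"
  shows "(\<Sum>\<theta> | \<theta> permutes {..<3::nat}. f (permute_list \<theta> [a, b, c])) =
    f [a, b, c] + f [a, c, b] + f [b, a, c] + f [b, c, a] + f [c, a, b] + f [c, b, a]"
proof -
  have "{..<3} = {0, 1, 2::nat}" by auto
  \<comment> \<open>A permutation of a set with one more point is uniquely a transposition moving
    that point after a permutation of the rest; unfolding this yields the six
    rearrangements.\<close>
  then have "(\<Sum>\<theta> | \<theta> permutes {..<3::nat}. f (permute_list \<theta> [a, b, c])) =
      f [a, b, c] + f [a, c, b] + (f [b, a, c] + f [b, c, a] + (f [c, b, a] + f [c, a, b]))"
    by (simp add: sum_over_permutations_insert) (simp add: permute_list_def transpose_def upt_rec ac_simps)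
  then show ?thesis
    by (simp add: ac_simps)
qed

text \<open>The hypothesis forces total degree 3 and names the letters of the ordered word. The sum
  runs over permutations rather than distinct words, so repeated letters produce repeated
  terms.\<close>

lemma symmetrization_mon_3:
  assumes "replicate i X3 @ replicate j Y3 @ replicate k Z3 = [a, b, c]"
  shows "symmetrization (basis (mon i j k)) = scale (1 / 6)
    (basis [a, b, c] + basis [a, c, b] + basis [b, a, c]
     + basis [b, c, a] + basis [c, a, b] + basis [c, b, a])"
  using sum_permutations_3[of basis a b c]
  by (simp add: symmetrization_def ordered_word_mon assms Let_def fact_numeral numeral_3_eq_3)

lemma symmetrization_mon_Z3: "symmetrization (basis (mon 0 0 1)) = gen Z3"
proof -
  have "{\<theta>. \<theta> permutes {0::nat}} = {id}" by auto
  then show ?thesis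
  by (simp add: symmetrization_def ordered_word_mon Let_def gen_def lessThan_Suc)
qed

lemma symmetrization_mon:
  "symmetrization (basis (mon 3 0 0)) = (basis [X3, X3, X3] :: (xyz, 'k::field_char_0) free_alg)"
  "symmetrization (basis (mon 2 1 0)) =
    (scale (1 / 3) (basis [X3, X3, Y3] + basis [X3, Y3, X3] + basis [Y3, X3, X3]) :: (xyz, 'k) free_alg)"
  "symmetrization (basis (mon 1 2 0)) =
    (scale (1 / 3) (basis [X3, Y3, Y3] + basis [Y3, X3, Y3] + basis [Y3, Y3, X3]) :: (xyz, 'k) free_alg)"
  "symmetrization (basis (mon 0 3 0)) = (basis [Y3, Y3, Y3] :: (xyz, 'k) free_alg)"
proof -
  \<comment> \<open>Comparing coefficients after clearing the denominator 6 absorbs these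
    repetitions: a word with exactly two equal letters arises twice, a power of one letter six
    times.\<close>
  have *: "symmetrization (basis (mon i j 0)) = u"
    if "replicate i X3 @ replicate j Y3 = [a, b, c]"
      "\<And>v. 6 * Poly_Mapping.lookup u v = Poly_Mapping.lookup (basis [a, b, c] + basis [a, c, b] + basis [b, a, c]
         + basis [b, c, a] + basis [c, a, b] + basis [c, b, a]) v"
    for i j a b c and u :: "(xyz, 'k) free_alg"
    using that(1) by (subst symmetrization_mon_3[of i j 0 a b c])
      (auto intro!: poly_mapping_eqI simp flip: that(2))
  show "symmetrization (basis (mon 3 0 0)) = (basis [X3, X3, X3] :: (xyz, 'k) free_alg)"
    by (rule *[of _ _ X3 X3 X3]) (simp_all add: numeral_eq_Suc lookup_add)
  show "symmetrization (basis (mon 0 3 0)) = (basis [Y3, Y3, Y3] :: (xyz, 'k) free_alg)"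
    by (rule *[of _ _ Y3 Y3 Y3]) (simp_all add: numeral_eq_Suc lookup_add)
  show "symmetrization (basis (mon 2 1 0)) =
    (scale (1 / 3) (basis [X3, X3, Y3] + basis [X3, Y3, X3] + basis [Y3, X3, X3]) :: (xyz, 'k) free_alg)"
    by (rule *[of _ _ X3 X3 Y3]) (simp_all add: numeral_2_eq_2 lookup_add)
  show "symmetrization (basis (mon 1 2 0)) =
    (scale (1 / 3) (basis [X3, Y3, Y3] + basis [Y3, X3, Y3] + basis [Y3, Y3, X3]) :: (xyz, 'k) free_alg)"
    by (rule *[of _ _ X3 Y3 Y3]) (simp_all add: numeral_2_eq_2 lookup_add)
qed

text \<open>\<open>cyc\<close> replaces each coefficient by its average over the rotation orbit,
  while the commutative image adds the coefficients of words with equal content. Both are thus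
  determined by the orbit averages; the orbits of \<open>xxyy\<close> and \<open>xyxy\<close>, of
  sizes 4 and 2, both contribute to \<open>x^2 y^2\<close>, whence
  \<open>4 * b + 2 * d\<close>.\<close>

lemma cyc_normal_form:
  fixes w :: "(xy, 'k::field_char_0) free_alg"
  assumes "w \<in> tensor_power 4"
  obtains a0 a1 b d a3 a4 where "cyc w = cyclic_form a0 a1 b d a3 a4"
    and "poly_incl (commutative_image w) =
      scale a0 (basis (mon 4 0 0)) + scale (4 * a1) (basis (mon 3 1 0))
      + scale (4 * b + 2 * d) (basis (mon 2 2 0)) + scale (4 * a3) (basis (mon 1 3 0))
      + scale a4 (basis (mon 0 4 0))"
proof -
  have W: "{v :: xy list. length v = 4} = {
     [Y2, Y2, Y2, Y2], [Y2, Y2, Y2, X2], [Y2, Y2, X2, Y2], [Y2, Y2, X2, X2],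
     [Y2, X2, Y2, Y2], [Y2, X2, Y2, X2], [Y2, X2, X2, Y2], [Y2, X2, X2, X2],
     [X2, Y2, Y2, Y2], [X2, Y2, Y2, X2], [X2, Y2, X2, Y2], [X2, Y2, X2, X2],
     [X2, X2, Y2, Y2], [X2, X2, Y2, X2], [X2, X2, X2, Y2], [X2, X2, X2, X2]}"
    by (simp add: numeral_eq_Suc words_Suc)
  define p where "p = Poly_Mapping.lookup w"
  have w: "w = (\<Sum>v | length v = 4. scale (p v) (basis v))"
    using tensor_power_sum_words[OF assms] by (simp add: p_def)
  have cyc_sum: "cyc w = (\<Sum>v | length v = 4. scale (p v) (cyc (basis v)))"
    by (subst w)
       (simp add: cyc_def rot4_def eval_nat_numeral lin_sum lin_scale sum.distrib pm.scale_sum_right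
         pm.scale_right_distrib mult.commute)
  have incl_sum: "poly_incl (commutative_image w) =
      (\<Sum>v | length v = 4. scale (p v) (poly_incl (commutative_image (basis v))))"
    by (subst w) (simp add: poly_incl_def commutative_image_def lin_sum lin_scale)
  have cyc_basis: "cyc (basis [s, t, u, v]) = scale (1 / 4)
      (basis [s, t, u, v] + basis [v, s, t, u] + basis [u, v, s, t] + basis [t, u, v, s])"
    for s t u v
    by (simp add: cyc_def rot4_def eval_nat_numeral algebra_simps)
  \<comment> \<open>Counting letters in explicit words evaluates to successor terms, so the numeral
    exponents are brought to that shape.\<close>
  have mon_Suc: "mon 4 0 0 = mon (Suc (Suc (Suc (Suc 0)))) 0 0"
    "mon 3 (Suc 0) 0 = mon (Suc (Suc (Suc 0))) (Suc 0) 0"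
    "mon 2 2 0 = mon (Suc (Suc 0)) (Suc (Suc 0)) 0"
    "mon (Suc 0) 3 0 = mon (Suc 0) (Suc (Suc (Suc 0))) 0"
    "mon 0 4 0 = mon 0 (Suc (Suc (Suc (Suc 0)))) 0"
    by (simp_all add: numeral_eq_Suc)
  show ?thesis
  proof (rule that)
    show "cyc w = cyclic_form (p [X2, X2, X2, X2])
       ((p [X2, X2, X2, Y2] + p [X2, X2, Y2, X2] + p [X2, Y2, X2, X2] + p [Y2, X2, X2, X2]) / 4)
       ((p [X2, X2, Y2, Y2] + p [X2, Y2, Y2, X2] + p [Y2, Y2, X2, X2] + p [Y2, X2, X2, Y2]) / 4)
       ((p [X2, Y2, X2, Y2] + p [Y2, X2, Y2, X2]) / 2)
       ((p [Y2, Y2, Y2, X2] + p [Y2, Y2, X2, Y2] + p [Y2, X2, Y2, Y2] + p [X2, Y2, Y2, Y2]) / 4)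
       (p [Y2, Y2, Y2, Y2])"
      unfolding cyc_sum W
      by (rule poly_mapping_eqI)
         (simp add: cyc_basis cyclic_form_def lookup_add field_simps)
    show "poly_incl (commutative_image w) =
      scale (p [X2, X2, X2, X2]) (basis (mon 4 0 0)) +
      scale (4 * ((p [X2, X2, X2, Y2] + p [X2, X2, Y2, X2] + p [X2, Y2, X2, X2] + p [Y2, X2, X2, X2]) / 4))
        (basis (mon 3 1 0)) +
      scale (4 * ((p [X2, X2, Y2, Y2] + p [X2, Y2, Y2, X2] + p [Y2, Y2, X2, X2] + p [Y2, X2, X2, Y2]) / 4) +
         2 * ((p [X2, Y2, X2, Y2] + p [Y2, X2, Y2, X2]) / 2)) (basis (mon 2 2 0)) +
      scale (4 * ((p [Y2, Y2, Y2, X2] + p [Y2, Y2, X2, Y2] + p [Y2, X2, Y2, Y2] + p [X2, Y2, Y2, Y2]) / 4))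
        (basis (mon 1 3 0)) +
      scale (p [Y2, Y2, Y2, Y2]) (basis (mon 0 4 0))"
      unfolding incl_sum W
      by (rule poly_mapping_eqI)
         (simp add: poly_incl_commutative_image_basis mon_Suc lookup_add field_simps)
  qed
qed

section \<open>The symmetric and alternating parts\<close>

text \<open>Place permutations preserve the number of letters \<open>y\<close>. Coefficients
  depending on that number alone are therefore constant along them, and reindexing the expansion by
  \<open>\<theta>\<close> returns \<open>u\<close>.\<close>

lemma Sym_tensorsI:
  assumes "u \<in> tensor_power m"
    and count: "\<And>v v'. length v = m \<Longrightarrow> length v' = m \<Longrightarrow> count_list v Y2 = count_list v' Y2 \<Longrightarrow>
      Poly_Mapping.lookup u v = Poly_Mapping.lookup u v'"
  shows "u \<in> Sym_tensors m"
proof -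
  have "perm_act \<theta> u = u" if \<theta>: "\<theta> permutes {..<m}" for \<theta>
  proof -
    let ?W = "{v :: xy list. length v = m}"
    have inv: "permute_list \<theta> (permute_list (inv_into UNIV \<theta>) v) = v"
      "permute_list (inv_into UNIV \<theta>) (permute_list \<theta> v) = v" if "length v = m" for v :: "xy list"
      using \<theta> that
      by (simp_all add: permutes_inv permutes_inv_o flip: permute_list_compose)
    have *: "Poly_Mapping.lookup u (permute_list \<theta> v) = Poly_Mapping.lookup u v"
      if "length v = m" for v
      using \<theta> that by (intro count) (simp_all flip: count_mset)
    have "perm_act \<theta> u = (\<Sum>v\<in>?W. scale (Poly_Mapping.lookup u v) (basis (permute_list \<theta> v)))"
      by (subst tensor_power_sum_words[OF assms(1)]) (simp add: perm_act_def lin_sum lin_scale)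
    also have "\<dots> = (\<Sum>v\<in>?W. scale (Poly_Mapping.lookup u v) (basis v))"
      by (rule sum.reindex_bij_witness[of _ "permute_list (inv_into UNIV \<theta>)" "permute_list \<theta>"])
         (simp_all add: inv *)
    also have "\<dots> = u"
      using tensor_power_sum_words[OF assms(1)] by simp
    finally show ?thesis .
  qed
  with assms(1) show ?thesis
    by (simp add: Sym_tensors_def)
qed

lemma tensor_power_add: "u \<in> tensor_power m \<Longrightarrow> v \<in> tensor_power m \<Longrightarrow> u + v \<in> tensor_power m"
  using keys_add[of u v] by (auto simp: tensor_power_def)

lemma tensor_power_scale: "u \<in> tensor_power m \<Longrightarrow> scale c u \<in> tensor_power m"
  by (auto simp: tensor_power_def in_keys_iff)

lemma tensor_power_basis: "length v = m \<Longrightarrow> basis v \<in> tensor_power m"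
  by (simp add: tensor_power_def basis_def)

text \<open>Once \<open>d = b\<close>, the two orbits with two letters \<open>y\<close> carry the
  same coefficient. Read contrapositively, a cyclic tensor that is not symmetric has
  \<open>d \<noteq> b\<close>.\<close>

lemma cyclic_form_Sym: "cyclic_form a0 a1 b b a3 a4 \<in> Sym_tensors 4"
proof (rule Sym_tensorsI)
  show "cyclic_form a0 a1 b b a3 a4 \<in> tensor_power 4"
    unfolding cyclic_form_def
    by (intro tensor_power_add tensor_power_scale tensor_power_basis) simp_all
next
  fix v v' :: "xy list"
  assume "length v = 4" "length v' = 4" and eq: "count_list v Y2 = count_list v' Y2"
  have "Poly_Mapping.lookup (cyclic_form a0 a1 b b a3 a4) u = [a0, a1, b, a3, a4] ! count_list u Y2"
    if "length u = 4" for u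
  proof -
    obtain p q r s where "u = [p, q, r, s]"
      using \<open>length u = 4\<close> that by (auto simp: numeral_eq_Suc length_Suc_conv)
    then show ?thesis
      by (cases p; cases q; cases r; cases s)
         (simp_all add: cyclic_form_def lookup_add lookup_basis)
  qed
  with \<open>length v = 4\<close> \<open>length v' = 4\<close> eq
  show "Poly_Mapping.lookup (cyclic_form a0 a1 b b a3 a4) v =
      Poly_Mapping.lookup (cyclic_form a0 a1 b b a3 a4) v'"
    by simp
qed

section \<open>Symmetric and alternating tensors of degree two\<close>

lemma permutes_lessThan_2: "\<theta> permutes {..<2::nat} \<longleftrightarrow> \<theta> = id \<or> \<theta> = transpose 0 1"
proof -
  have "{..<2} = {0, 1::nat}" by auto
  then show ?thesis by (simp add: permutes_doubleton_iff)
qed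

lemma perm_act_id: "perm_act id u = u"
  using sum_lookup_basis[of u] by (simp add: perm_act_def lin_def)

lemma perm_act_transpose_basis: "perm_act (transpose 0 1) (basis [a, b]) = basis [b, a]"
  by (simp add: perm_act_def permute_list_def upt_rec)

lemma perm_act_add: "perm_act \<theta> (u + v) = perm_act \<theta> u + perm_act \<theta> v"
  by (simp add: perm_act_def lin_add)

lemma perm_act_scale: "perm_act \<theta> (scale c u) = scale c (perm_act \<theta> u)"
  by (simp add: perm_act_def lin_scale)

lemma perm_act_diff: "perm_act \<theta> (u - v) = perm_act \<theta> u - perm_act \<theta> v"
  by (simp add: perm_act_def lin_diff)

lemma Sym_tensors_2:
  "u \<in> Sym_tensors 2 \<longleftrightarrow> u \<in> tensor_power 2 \<and> perm_act (transpose 0 1) u = u"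
  by (auto simp: Sym_tensors_def permutes_lessThan_2 perm_act_id)

lemma Alt_tensors_2:
  "u \<in> Alt_tensors 2 \<longleftrightarrow> u \<in> tensor_power 2 \<and> perm_act (transpose 0 1) u = - u"
  by (auto simp: Alt_tensors_def permutes_lessThan_2 perm_act_id sign_id sign_swap_id)

text \<open>A generator of the line Alt^2 V, that is, x wedge y up to normalization.\<close>

definition alt_xy :: "(xy, 'k::field) free_alg"
  where "alt_xy = basis [X2, Y2] - basis [Y2, X2]"

lemma alt_xy_Alt: "alt_xy \<in> Alt_tensors 2"
  using tensor_power_add[OF tensor_power_basis[of "[X2, Y2]" 2]
      tensor_power_scale[OF tensor_power_basis[of "[Y2, X2]" 2], of "- 1"]]
  by (simp add: Alt_tensors_2 alt_xy_def perm_act_diff perm_act_transpose_basis[simplified])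

lemma basis_Sym: "basis [a, a] \<in> Sym_tensors 2"
  by (simp add: Sym_tensors_2 tensor_power_basis perm_act_transpose_basis[simplified])

lemma sum_basis_Sym: "basis [a, b] + basis [b, a] \<in> Sym_tensors 2"
  by (simp add: Sym_tensors_2 tensor_power_basis tensor_power_add perm_act_add
      perm_act_transpose_basis[simplified] add.commute)

lemma lookup_perm_act_transpose:
  assumes "u \<in> tensor_power 2"
  shows "Poly_Mapping.lookup (perm_act (transpose 0 1) u) [s, t] = Poly_Mapping.lookup u [t, s]"
proof -
  obtain a b c d where u: "u = scale a (basis [X2, X2]) + scale b (basis [X2, Y2])
    + scale c (basis [Y2, X2]) + scale d (basis [Y2, Y2])"
    using assms by (rule tensor_power_2_cases)
  show ?thesis
    unfolding u perm_act_add perm_act_scale perm_act_transpose_basis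
    by (cases s; cases t) (simp_all add: lookup_add lookup_basis)
qed

lemma Alt_tensors_2_cases:
  fixes u :: "(xy, 'k::field_char_0) free_alg"
  assumes "u \<in> Alt_tensors 2"
  obtains c where "u = scale c alt_xy"
proof -
  obtain a b c d where u: "u = scale a (basis [X2, X2]) + scale b (basis [X2, Y2])
    + scale c (basis [Y2, X2]) + scale d (basis [Y2, Y2])"
    by (rule tensor_power_2_cases[of u]) (use assms in \<open>auto simp: Alt_tensors_2\<close>)
  have swap: "Poly_Mapping.lookup u [s, t] = - Poly_Mapping.lookup u [t, s]" for s t
    using assms lookup_perm_act_transpose[of u t s] by (simp add: Alt_tensors_2)
  \<comment> \<open>For \<open>a\<close> and \<open>d\<close> antisymmetry says that the coefficient
    equals its own negative, so it vanishes in characteristic 0.\<close>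
  have "a = 0" "c = - b" "d = 0"
    using swap[of X2 X2] swap[of Y2 X2] swap[of Y2 Y2]
    by (simp_all add: u lookup_add lookup_minus lookup_basis)
  then have "u = scale b alt_xy"
    by (simp add: u alt_xy_def pm.scale_right_diff_distrib)
  then show ?thesis by (rule that)
qed

lemma w0_eq: "w0 = alt_xy * alt_xy"
  by (simp add: w0_def alt_xy_def algebra_simps basis_mult_word)

lemma tensor_prod_Alt:
  fixes u :: "(xy, 'k::field_char_0) free_alg"
  assumes "u \<in> tensor_prod (Alt_tensors 2) (Alt_tensors 2)"
  obtains c where "u = scale c w0"
proof -
  have "u \<in> pm_span {w0}"
    using assms unfolding tensor_prod_def
  proof (rule subsetD[OF pm.span_minimal, rotated 2])
    show "{a * b |a b. a \<in> Alt_tensors 2 \<and> b \<in> Alt_tensors 2} \<subseteq> pm_span {w0 :: (xy, 'k) free_alg}"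
      by (auto elim!: Alt_tensors_2_cases
          simp: scale_mult_left scale_mult_right pm.span_singleton simp flip: w0_eq)
  qed (rule pm.subspace_span)
  then show ?thesis
    using that by (auto simp: pm.span_singleton)
qed

text \<open>The linear functional whose signs are the coefficients of \<open>w0\<close>. It kills
  the three summands with a symmetric factor and takes the value 4 at \<open>w0\<close>, so it
  detects the component in the last summand and equals four times the functional of the
  projection.\<close>

definition alt_coeff :: "(xy, 'k) free_alg \<Rightarrow> 'k::field"
  where "alt_coeff u = Poly_Mapping.lookup u [X2, Y2, X2, Y2] - Poly_Mapping.lookup u [X2, Y2, Y2, X2]
    - Poly_Mapping.lookup u [Y2, X2, X2, Y2] + Poly_Mapping.lookup u [Y2, X2, Y2, X2]"

lemma alt_coeff_add: "alt_coeff (u + v) = alt_coeff u + alt_coeff v"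
  by (simp add: alt_coeff_def lookup_add)

lemma alt_coeff_scale: "alt_coeff (scale c u) = c * alt_coeff u"
  by (simp add: alt_coeff_def algebra_simps)

lemma alt_coeff_w0: "alt_coeff w0 = 4"
  by (simp add: alt_coeff_def w0_def lookup_add lookup_minus lookup_basis)

text \<open>The functional is the tensor square of the difference of the coefficients at
  \<open>xy\<close> and \<open>yx\<close>, and that difference vanishes on symmetric
  tensors.\<close>

lemma alt_coeff_mult:
  assumes "u \<in> tensor_power 2" "v \<in> tensor_power 2"
  shows "alt_coeff (u * v) = (Poly_Mapping.lookup u [X2, Y2] - Poly_Mapping.lookup u [Y2, X2])
    * (Poly_Mapping.lookup v [X2, Y2] - Poly_Mapping.lookup v [Y2, X2])"
  by (rule tensor_power_2_cases[OF assms(1)], rule tensor_power_2_cases[OF assms(2)])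
     (simp add: alt_coeff_def scale_mult_left scale_mult_right
       basis_mult_word lookup_add lookup_basis algebra_simps)

lemma Sym_tensors_2_lookup:
  assumes "u \<in> Sym_tensors 2"
  shows "Poly_Mapping.lookup u [s, t] = Poly_Mapping.lookup u [t, s]"
  using assms lookup_perm_act_transpose[of u t s] by (simp add: Sym_tensors_2)

lemma alt_coeff_tensor_prod:
  assumes "u \<in> tensor_prod A B" "A \<subseteq> tensor_power 2" "B \<subseteq> tensor_power 2"
    and "A \<subseteq> Sym_tensors 2 \<or> B \<subseteq> Sym_tensors 2"
  shows "alt_coeff u = 0"
proof -
  have "u \<in> {u. alt_coeff u = 0}"
    using assms(1) unfolding tensor_prod_def
  proof (rule subsetD[OF pm.span_minimal, rotated 2])
    show "{a * b |a b. a \<in> A \<and> b \<in> B} \<subseteq> {u. alt_coeff u = 0}"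
    proof clarify
      fix a b assume "a \<in> A" "b \<in> B"
      then show "alt_coeff (a * b) = 0"
        using assms(2-4) Sym_tensors_2_lookup[of _ X2 Y2] by (subst alt_coeff_mult) auto
    qed
    show "pm.subspace {u. alt_coeff u = (0::'a)}"
      by (rule pm.subspaceI) (simp_all add: alt_coeff_add alt_coeff_scale alt_coeff_def[of 0])
  qed
  then show ?thesis by simp
qed

text \<open>Treats tensors without mixed components, which suffices for cyclic ones. Uniqueness of
  the projection comes from \<open>alt_coeff\<close>: it sees only the last component, which is a
  multiple of \<open>w0\<close>, and so fixes the multiple.\<close>

lemma proj_alt_eqI:
  fixes u :: "(xy, 'k::field_char_0) free_alg"
  assumes "u = q + scale m w0" "q \<in> tensor_prod (Sym_tensors 2) (Sym_tensors 2)"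
  shows "proj_alt u = scale m w0"
  unfolding proj_alt_def
proof (rule the_equality, intro conjI bexI)
  show "scale m w0 \<in> tensor_prod (Alt_tensors 2) (Alt_tensors 2)"
    unfolding tensor_prod_def w0_eq by (intro pm.span_scale pm.span_base) (auto intro: alt_xy_Alt)
  show "u = q + 0 + 0 + scale m w0" "q \<in> tensor_prod (Sym_tensors 2) (Sym_tensors 2)"
    using assms by simp_all
  show "0 \<in> tensor_prod (Sym_tensors 2) (Alt_tensors 2)" "0 \<in> tensor_prod (Alt_tensors 2) (Sym_tensors 2)"
    unfolding tensor_prod_def by (rule pm.span_zero)+
next
  fix p
  assume "p \<in> tensor_prod (Alt_tensors 2) (Alt_tensors 2) \<and>
    (\<exists>q \<in> tensor_prod (Sym_tensors 2) (Sym_tensors 2).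
     \<exists>r \<in> tensor_prod (Sym_tensors 2) (Alt_tensors 2).
     \<exists>s \<in> tensor_prod (Alt_tensors 2) (Sym_tensors 2). u = q + r + s + p)"
  then obtain q' r s where p: "p \<in> tensor_prod (Alt_tensors 2) (Alt_tensors 2)"
    and q': "q' \<in> tensor_prod (Sym_tensors 2) (Sym_tensors 2)"
    and r: "r \<in> tensor_prod (Sym_tensors 2) (Alt_tensors 2)"
    and s: "s \<in> tensor_prod (Alt_tensors 2) (Sym_tensors 2)" and u: "u = q' + r + s + p"
    by blast
  have le: "Sym_tensors 2 \<subseteq> (tensor_power 2 :: (xy, 'k) free_alg set)"
    "Alt_tensors 2 \<subseteq> (tensor_power 2 :: (xy, 'k) free_alg set)"
    by (auto simp: Sym_tensors_def Alt_tensors_def)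
  obtain c where c: "p = scale c w0"
    using p by (rule tensor_prod_Alt)
  have "alt_coeff u = alt_coeff p"
    unfolding u alt_coeff_add
    using alt_coeff_tensor_prod[OF q'] alt_coeff_tensor_prod[OF r] alt_coeff_tensor_prod[OF s] le
    by simp
  moreover have "alt_coeff u = alt_coeff (scale m w0)"
    using assms le by (simp add: alt_coeff_add alt_coeff_tensor_prod)
  ultimately have "c = m"
    by (simp add: c alt_coeff_scale alt_coeff_w0)
  with c show "p = scale m w0" by simp
qed

lemma mu_cyclic_form:
  fixes a0 a1 b d a3 a4 :: "'k::field_char_0"
  shows "mu (cyclic_form a0 a1 b d a3 a4) = (d - b) / 2"
proof -
  let ?x = "basis [X2, X2] :: (xy, 'k) free_alg" and ?y = "basis [Y2, Y2] :: (xy, 'k) free_alg"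
  let ?s = "basis [X2, Y2] + basis [Y2, X2] :: (xy, 'k) free_alg"
  \<comment> \<open>On \<open>xyxy\<close> and \<open>xyyx\<close> the product
    \<open>?s * ?s\<close> has coefficients 1 and 1, \<open>w0\<close> has 1 and -1. Matching
    \<open>d\<close> and \<open>b\<close> forces the factors \<open>(b + d) / 2\<close> and
    \<open>(d - b) / 2\<close>.\<close>
  let ?q = "scale a0 (?x * ?x) + scale a1 (?x * ?s + ?s * ?x) + scale b (?x * ?y + ?y * ?x)
    + scale ((b + d) / 2) (?s * ?s) + scale a3 (?y * ?s + ?s * ?y) + scale a4 (?y * ?y)"
  have "?q \<in> tensor_prod (Sym_tensors 2) (Sym_tensors 2)"
    unfolding tensor_prod_def
    by (intro pm.span_add pm.span_scale pm.span_base) (blast intro: basis_Sym sum_basis_Sym)+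
  moreover have "cyclic_form a0 a1 b d a3 a4 = ?q + scale ((d - b) / 2) w0"
    by (rule poly_mapping_eqI)
       (simp add: cyclic_form_def w0_def distrib_left distrib_right basis_mult_word
         lookup_add lookup_minus field_simps)
  ultimately have *: "proj_alt (cyclic_form a0 a1 b d a3 a4) = scale ((d - b) / 2) w0"
    by (intro proj_alt_eqI)
  have "m = n" if "scale m w0 = scale n (w0 :: (xy, 'k) free_alg)" for m n
    using arg_cong[OF that, of alt_coeff] by (simp add: alt_coeff_scale alt_coeff_w0)
  then show ?thesis
    unfolding mu_def * by (intro the_equality) (simp_all add: eq_commute)
qed

section \<open>Comparison of the relations\<close>

lemma remove_initial_cyclic_form:
  "remove_initial X2 (cyclic_form a0 a1 b d a3 a4) =
    scale a0 (basis [X2, X2, X2])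
    + scale a1 (basis [X2, X2, Y2] + basis [X2, Y2, X2] + basis [Y2, X2, X2])
    + scale b (basis [X2, Y2, Y2] + basis [Y2, Y2, X2])
    + scale d (basis [Y2, X2, Y2]) + scale a3 (basis [Y2, Y2, Y2])"
  "remove_initial Y2 (cyclic_form a0 a1 b d a3 a4) =
    scale a1 (basis [X2, X2, X2])
    + scale b (basis [Y2, X2, X2] + basis [X2, X2, Y2])
    + scale d (basis [X2, Y2, X2])
    + scale a3 (basis [Y2, Y2, X2] + basis [Y2, X2, Y2] + basis [X2, Y2, Y2])
    + scale a4 (basis [Y2, Y2, Y2])"
  by (simp_all add: remove_initial_def cyclic_form_def lin_add lin_scale)

lemma symmetrization_add: "symmetrization (u + v) = symmetrization u + symmetrization v"
  and symmetrization_scale: "symmetrization (scale c u) = scale c (symmetrization u)"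
  by (simp_all add: symmetrization_def lin_add lin_scale)

lemma symmetrization_minus: "symmetrization (- u) = - symmetrization u"
  using symmetrization_scale[of "- 1" u] by simp

lemma partial_add: "partial s (u + v) = partial s u + partial s v"
  and partial_diff: "partial s (u - v) = partial s u - partial s v"
  and partial_scale: "partial s (scale c u) = scale c (partial s u)"
  by (simp_all add: partial_def lin_add lin_diff lin_scale)

section \<open>Elimination of \<open>z\<close> and the relations for the quartic
  \<open>f\<close>\<close>

fun incl_gen :: "xy \<Rightarrow> (xyz, 'k::field) free_alg"
  where "incl_gen X2 = gen X3" | "incl_gen Y2 = gen Y3"

fun elim_gen :: "xyz \<Rightarrow> (xy, 'k::field) free_alg"
  where "elim_gen X3 = gen X2" | "elim_gen Y3 = gen Y2" | "elim_gen Z3 = commutator (gen X2) (gen Y2)"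

text \<open>Symmetrizing the derivatives of \<open>f\<close> in \<open>x\<close> and
  \<open>y\<close> brings out a common factor 4, and \<open>4 * (- 3 / (8 * m))\<close> is
  \<open>- 3 / (2 * m)\<close>. The coefficient \<open>4 * b + 2 * d\<close> becomes
  \<open>2 * (4 * b + 2 * d) / 3\<close>, which is four times
  \<open>(2 * b + d) / 3\<close>.\<close>

lemma S_rels_quartic:
  fixes a0 a1 b d a3 a4 m :: "'k::field_char_0"
  assumes m: "m \<noteq> 0" and d: "d = b + 2 * m"
  defines "f \<equiv> scale a0 (basis (mon 4 0 0)) + scale (4 * a1) (basis (mon 3 1 0))
      + scale (4 * b + 2 * d) (basis (mon 2 2 0)) + scale (4 * a3) (basis (mon 1 3 0))
      + scale a4 (basis (mon 0 4 0)) - scale (4 * m / 3) (basis (mon 0 0 2))"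
  shows "S_rels (- 3 / (8 * m)) f =
   {commutator (gen Y3) (gen Z3) + scale (3 / (2 * m))
      (scale a0 (basis [X3, X3, X3])
       + scale a1 (basis [X3, X3, Y3] + basis [X3, Y3, X3] + basis [Y3, X3, X3])
       + scale ((2 * b + d) / 3) (basis [X3, Y3, Y3] + basis [Y3, X3, Y3] + basis [Y3, Y3, X3])
       + scale a3 (basis [Y3, Y3, Y3])),
    commutator (gen Z3) (gen X3) + scale (3 / (2 * m))
      (scale a1 (basis [X3, X3, X3])
       + scale ((2 * b + d) / 3) (basis [X3, X3, Y3] + basis [X3, Y3, X3] + basis [Y3, X3, X3])
       + scale a3 (basis [X3, Y3, Y3] + basis [Y3, X3, Y3] + basis [Y3, Y3, X3])
       + scale a4 (basis [Y3, Y3, Y3])),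
    commutator (gen X3) (gen Y3) - gen Z3}"
proof -
  note symmetrize = f_def partial_add partial_diff partial_scale partial_basis_mon
    symmetrization_add symmetrization_minus symmetrization_scale
    symmetrization_mon[simplified] symmetrization_mon_Z3[simplified]
  have "scale (- 3 / (8 * m)) (symmetrization (partial X3 f)) = - scale (3 / (2 * m))
      (scale a0 (basis [X3, X3, X3])
       + scale a1 (basis [X3, X3, Y3] + basis [X3, Y3, X3] + basis [Y3, X3, X3])
       + scale ((2 * b + d) / 3) (basis [X3, Y3, Y3] + basis [Y3, X3, Y3] + basis [Y3, Y3, X3])
       + scale a3 (basis [Y3, Y3, Y3]))"
    by (rule poly_mapping_eqI) (use m in \<open>simp add: symmetrize d lookup_add lookup_minus field_simps\<close>)
  moreover have "scale (- 3 / (8 * m)) (symmetrization (partial Y3 f)) = - scale (3 / (2 * m))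
      (scale a1 (basis [X3, X3, X3])
       + scale ((2 * b + d) / 3) (basis [X3, X3, Y3] + basis [X3, Y3, X3] + basis [Y3, X3, X3])
       + scale a3 (basis [X3, Y3, Y3] + basis [Y3, X3, Y3] + basis [Y3, Y3, X3])
       + scale a4 (basis [Y3, Y3, Y3]))"
    by (rule poly_mapping_eqI) (use m in \<open>simp add: symmetrize d lookup_add lookup_minus field_simps\<close>)
  \<comment> \<open>The derivative in \<open>z\<close> is \<open>- 8 * m / 3\<close> times
    \<open>z\<close>, and the scalar in front is the inverse of that factor.\<close>
  moreover have "scale (- 3 / (8 * m)) (symmetrization (partial Z3 f)) = gen Z3"
    by (rule poly_mapping_eqI) (use m in \<open>simp add: symmetrize d lookup_add lookup_minus field_simps\<close>)
  ultimately show ?thesis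
    by (simp add: S_rels_def)
qed

theorem theorem5p1:
  fixes w :: "(xy, 'k::{alg_closed_field, field_char_0}) free_alg"
  assumes "w \<in> tensor_power 4"
    and "cyc w \<notin> Sym_tensors 4"
  shows "let l = - 3 / (8 * mu (cyc w));
             f = poly_incl (commutative_image w)
                 - scale (4 * mu (cyc w) / 3) (basis (Poly_Mapping.single Z3 2))
         in \<exists>h \<in> graded_algebra_iso (jacobian_algebra w) (S_algebra l f).
              h (cls (J_rels w) (gen X2)) = cls (S_rels l f) (gen X3) \<and>
              h (cls (J_rels w) (gen Y2)) = cls (S_rels l f) (gen Y3)"
proof -
  obtain a0 a1 b d a3 a4 where cyc: "cyc w = cyclic_form a0 a1 b d a3 a4"
    and incl: "poly_incl (commutative_image w) =
      scale a0 (basis (mon 4 0 0)) + scale (4 * a1) (basis (mon 3 1 0))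
      + scale (4 * b + 2 * d) (basis (mon 2 2 0)) + scale (4 * a3) (basis (mon 1 3 0))
      + scale a4 (basis (mon 0 4 0))"
    using cyc_normal_form[OF assms(1)] .
  define m where "m = mu (cyc w)"
  have d: "d = b + 2 * m"
    by (simp add: m_def cyc mu_cyclic_form field_simps)
  \<comment> \<open>For \<open>m = 0\<close> one would have \<open>d = b\<close>, and
    \<open>cyc w\<close> would be symmetric.\<close>
  have m: "m \<noteq> 0"
    using assms(2) cyclic_form_Sym[of a0 a1 b a3 a4] d by (auto simp: cyc)
  define l where "l = - 3 / (8 * m)"
  define f where "f = poly_incl (commutative_image w) - scale (4 * m / 3) (basis (Poly_Mapping.single Z3 2))"
  define R where "R = J_rels w"
  define S where "S = S_rels l f"
  define r1 where "r1 = commutator (gen Y3) (gen Z3) + scale (3 / (2 * m))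
      (scale a0 (basis [X3, X3, X3])
       + scale a1 (basis [X3, X3, Y3] + basis [X3, Y3, X3] + basis [Y3, X3, X3])
       + scale ((2 * b + d) / 3) (basis [X3, Y3, Y3] + basis [Y3, X3, Y3] + basis [Y3, Y3, X3])
       + scale a3 (basis [Y3, Y3, Y3]))"
  define r2 where "r2 = commutator (gen Z3) (gen X3) + scale (3 / (2 * m))
      (scale a1 (basis [X3, X3, X3])
       + scale ((2 * b + d) / 3) (basis [X3, X3, Y3] + basis [X3, Y3, X3] + basis [Y3, X3, X3])
       + scale a3 (basis [X3, Y3, Y3] + basis [Y3, X3, Y3] + basis [Y3, Y3, X3])
       + scale a4 (basis [Y3, Y3, Y3]))"
  define r3 :: "(xyz, 'k) free_alg" where "r3 = commutator (gen X3) (gen Y3) - gen Z3"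
  define p where "p = remove_initial X2 (cyc w)"
  define q where "q = remove_initial Y2 (cyc w)"
  have R: "R = {p, q}"
    by (simp add: R_def J_rels_def p_def q_def)
  have S: "S = {r1, r2, r3}"
    unfolding S_def l_def f_def incl single_Z3 r1_def r2_def r3_def
    by (rule S_rels_quartic[OF m d])
  \<comment> \<open>Adding \<open>[y, r3]\<close> trades \<open>[y, z]\<close> for
    \<open>[y, [x, y]] = 2yxy - yyx - xyy\<close>. After scaling this turns the common coefficient
    \<open>(2 * b + d) / 3\<close> into \<open>d\<close> at \<open>yxy\<close> and into
    \<open>b\<close> at \<open>xyy\<close> and \<open>yyx\<close>.\<close>
  have incl_p: "subst_hom incl_gen p = scale (2 * m / 3) (r1 + commutator (gen Y3) r3)"
    unfolding p_def cyc remove_initial_cyclic_form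
    by (rule poly_mapping_eqI)
       (use m in \<open>simp add: r1_def r3_def d gen_def basis_mult_word commutator_def
          left_diff_distrib right_diff_distrib subst_hom_add subst_hom_scale
          lookup_add lookup_minus field_simps\<close>)
  \<comment> \<open>The same exchange with \<open>[[x, y], x] = 2xyx - yxx - xxy\<close>.\<close>
  have incl_q: "subst_hom incl_gen q = scale (2 * m / 3) (r2 + commutator r3 (gen X3))"
    unfolding q_def cyc remove_initial_cyclic_form
    by (rule poly_mapping_eqI)
       (use m in \<open>simp add: r2_def r3_def d gen_def basis_mult_word commutator_def
          left_diff_distrib right_diff_distrib subst_hom_add subst_hom_scale
          lookup_add lookup_minus field_simps\<close>)
  \<comment> \<open>The scalar is inverse to the one in \<open>incl_p\<close>, in accordance with
    \<open>elim_gen\<close> sending \<open>r3\<close> to 0.\<close>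
  have elim_r1: "subst_hom elim_gen r1 = scale (3 / (2 * m)) p"
    unfolding p_def cyc remove_initial_cyclic_form
    by (rule poly_mapping_eqI)
       (use m in \<open>simp add: r1_def d gen_def basis_mult_word commutator_def
          left_diff_distrib right_diff_distrib subst_hom_add subst_hom_diff subst_hom_scale
          lookup_add lookup_minus field_simps\<close>)
  have elim_r2: "subst_hom elim_gen r2 = scale (3 / (2 * m)) q"
    unfolding q_def cyc remove_initial_cyclic_form
    by (rule poly_mapping_eqI)
       (use m in \<open>simp add: r2_def d gen_def basis_mult_word commutator_def
          left_diff_distrib right_diff_distrib subst_hom_add subst_hom_diff subst_hom_scale
          lookup_add lookup_minus field_simps\<close>)
  have elim_r3: "subst_hom elim_gen r3 = 0"
    by (simp add: r3_def commutator_def subst_hom_diff subst_hom_mult)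
  have r: "r1 \<in> Idl_free S" "r2 \<in> Idl_free S" "r3 \<in> Idl_free S"
    and pq: "p \<in> Idl_free R" "q \<in> Idl_free R"
    by (simp_all add: R S Idl_free_self)
  obtain h where h: "h \<in> graded_algebra_iso (presented_algebra (\<lambda>_. 1) R) (presented_algebra deg_xyz S)"
    and h_cls: "\<And>u. h (cls R u) = cls S (subst_hom incl_gen u)"
  proof (rule presented_algebra_iso)
    show "incl_gen a \<in> homogeneous deg_xyz 1" for a
      by (cases a) (simp_all add: gen_def homogeneous_basis)
    show "elim_gen b \<in> homogeneous (\<lambda>_. 1) (deg_xyz b)" for b
      by (cases b) (simp_all add: gen_def commutator_def basis_mult_word homogeneous_basis homogeneous_diff)
    show "subst_hom incl_gen ` R \<subseteq> Idl_free S"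
      using r by (simp add: R incl_p incl_q commutator_def Idl_free_scale Idl_free_add
          Idl_free_diff Idl_free_mult_left Idl_free_mult_right)
    show "subst_hom elim_gen ` S \<subseteq> Idl_free R"
      using pq by (auto simp: S elim_r1 elim_r2 elim_r3 intro!: Idl_free_scale)
    show "subst_hom elim_gen (incl_gen a) - gen a \<in> Idl_free R" for a
      by (cases a) simp_all
    \<comment> \<open>The difference is 0 for \<open>X3\<close> and \<open>Y3\<close>; for
      \<open>Z3\<close> it is exactly \<open>r3\<close>.\<close>
    show "subst_hom incl_gen (elim_gen b) - gen b \<in> Idl_free S" for b
      using r(3) by (cases b) (simp_all add: r3_def commutator_def subst_hom_diff subst_hom_mult)
  qed (rule that)
  from h h_cls[of "gen X2"] h_cls[of "gen Y2"] show ?thesis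
    unfolding Let_def m_def[symmetric] l_def[symmetric] f_def[symmetric]
      jacobian_algebra_def S_algebra_def R_def[symmetric] S_def[symmetric]
    by auto
qed

end
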